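(* $R(4)=7$, where for a positive integer $\omega$, $R(\omega)$ denotes the maximum number of colors that Builder can force Algorithm to use in the on-line proper interval coloring game with clique bound $\omega$.
   Context: The on-line proper interval coloring game with clique bound $\omega$ (a positive integer) is a two-player game between Builder and Algorithm, played in rounds. In each round, Builder presents a closed interval on the real line that is neither contained in nor contains any previously presented interval. Algorithm then immediately and irrevocably assigns the interval a color that has not been assigned to any previously presented interval intersecting it. The presented intervals form an interval representation of a unit interval graph (vertices are the intervals; two are adjacent if and only if the intervals intersect) and the colors form a proper coloring of that graph. Builder is restricted so that the graph constructed never contains a clique of size $\omega+1$ (equivalently, no real number lies in more than $\omega$ of the presented intervals). Builder may adapt to the colors chosen by Algorithm, and the game is finite. $R(\omega)$ is the maximum integer $m$ such that Builder has a strategy that forces Algorithm, however it plays, to use (at least) $m$ distinct colors. *)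

theory Defs
  imports Complex_Main
begin

text \<open>
  A position is the list of rounds played so far, in chronological order: the interval that
  Builder presented, together with the color that Algorithm gave it.  Colors are natural
  numbers, so Algorithm never runs out of them.
\<close>

type_synonym color = nat
type_synonym position = "(real set \<times> color) list"

definition closed_interval :: "real set \<Rightarrow> bool" where
  "closed_interval I \<longleftrightarrow> (\<exists>a b. a \<le> b \<and> I = {a..b})"

definition intervals :: "position \<Rightarrow> real set set" where
  "intervals h = fst ` set h"

definition colors :: "position \<Rightarrow> color set" where
  "colors h = snd ` set h"

definition adjacent :: "real set \<Rightarrow> real set \<Rightarrow> bool" where
  "adjacent I J \<longleftrightarrow> I \<noteq> J \<and> I \<inter> J \<noteq> {}"

definition clique :: "real set set \<Rightarrow> real set set \<Rightarrow> bool" where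
  "clique V K \<longleftrightarrow> K \<subseteq> V \<and> pairwise adjacent K"

definition legal_interval :: "nat \<Rightarrow> position \<Rightarrow> real set \<Rightarrow> bool" where
  "legal_interval \<omega> h I \<longleftrightarrow>
     closed_interval I \<and>
     (\<forall>J \<in> intervals h. \<not> I \<subseteq> J \<and> \<not> J \<subseteq> I) \<and>
     \<not> (\<exists>K. clique (insert I (intervals h)) K \<and> card K = \<omega> + 1)"

definition legal_color :: "position \<Rightarrow> real set \<Rightarrow> color \<Rightarrow> bool" where
  "legal_color h I c \<longleftrightarrow> (\<forall>(J, d) \<in> set h. I \<inter> J \<noteq> {} \<longrightarrow> c \<noteq> d)"

text \<open>
  A strategy of Builder maps a position to the next interval, or to \<^term>\<open>None\<close> to end the game.
  The positions that can arise when Builder follows \<open>\<sigma>\<close> and Algorithm plays any legal colors: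
\<close>

type_synonym strategy = "position \<Rightarrow> real set option"

inductive reachable :: "strategy \<Rightarrow> position \<Rightarrow> bool" for \<sigma> :: strategy where
  start: "reachable \<sigma> []"
| round: "reachable \<sigma> h \<Longrightarrow> \<sigma> h = Some I \<Longrightarrow> legal_color h I c \<Longrightarrow> reachable \<sigma> (h @ [(I, c)])"

definition legal_strategy :: "nat \<Rightarrow> strategy \<Rightarrow> bool" where
  "legal_strategy \<omega> \<sigma> \<longleftrightarrow> (\<forall>h I. reachable \<sigma> h \<longrightarrow> \<sigma> h = Some I \<longrightarrow> legal_interval \<omega> h I)"

text \<open>Every play ends after finitely many rounds: no infinite sequence of rounds follows \<open>\<sigma>\<close>.\<close>

definition finite_game :: "strategy \<Rightarrow> bool" where
  "finite_game \<sigma> \<longleftrightarrow> \<not> (\<exists>p :: nat \<Rightarrow> real set \<times> color. \<forall>n. reachable \<sigma> (map p [0..<n]))"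

definition can_force :: "nat \<Rightarrow> nat \<Rightarrow> bool" where
  "can_force \<omega> m \<longleftrightarrow>
     (\<exists>\<sigma>. legal_strategy \<omega> \<sigma> \<and> finite_game \<sigma> \<and>
          (\<forall>h. reachable \<sigma> h \<and> \<sigma> h = None \<longrightarrow> m \<le> card (colors h)))"

definition R :: "nat \<Rightarrow> nat" where
  "R \<omega> = (GREATEST m. can_force \<omega> m)"

end

theory Submission
  imports Defs
begin

text \<open>
  Since no interval contains another, every interval that meets a new interval \<open>I\<close> contains one of
  the endpoints of \<open>I\<close>.  Through each endpoint pass at most \<open>\<omega> - 1\<close> earlier intervals, so first fit
  never needs a color beyond the first \<open>2\<omega> - 1\<close>; this gives \<open>R(4) \<le> 7\<close>.  For the other inequality,
  a game tree search found a strategy of Builder that forces a seventh color within 16 rounds.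
  Up to renaming colors Algorithm has finitely many answers in each round, so the strategy is a
  finite tree, whose correctness is checked by evaluation.
\<close>

section \<open>The upper bound: first fit\<close>

lemma finite_intervals [simp]: "finite (intervals h)"
  by (simp add: intervals_def)

lemma finite_colors [simp]: "finite (colors h)"
  by (simp add: colors_def)

text \<open>Two counts, one at each endpoint of \<open>I\<close>, with at most
  \<open>\<omega> - 1\<close> intervals each. An interval through both endpoints is counted twice,
  which does no harm to an upper bound.\<close>

lemma few_neighbours:
  assumes legal: "legal_interval \<omega> h I"
    and closed: "\<And>J. J \<in> intervals h \<Longrightarrow> closed_interval J"
    and \<omega>: "0 < \<omega>"
  shows "card {J \<in> intervals h. I \<inter> J \<noteq> {}} \<le> 2 * (\<omega> - 1)"
proof -
  obtain a b where I: "a \<le> b" "I = {a..b}"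
    using legal by (auto simp: legal_interval_def closed_interval_def)
  \<comment> \<open>Any \<open>\<omega>\<close> earlier intervals through \<open>x\<close>, together
    with \<open>I\<close> itself, would pairwise share \<open>x\<close> and form a forbidden
    clique.\<close>
  have few: "card {J \<in> intervals h. x \<in> J} \<le> \<omega> - 1" if "x \<in> I" for x
  proof (rule ccontr)
    assume "\<not> ?thesis"
    then have "\<omega> \<le> card {J \<in> intervals h. x \<in> J}"
      by simp
    then obtain K where K: "K \<subseteq> {J \<in> intervals h. x \<in> J}" "card K = \<omega>"
      by (rule obtain_subset_with_card_n)
    moreover have "I \<notin> K"
      using legal K(1) by (auto simp: legal_interval_def)
    moreover have "finite K"
      using K(1) by (rule finite_subset) simp
    ultimately have "card (insert I K) = \<omega> + 1"
      by auto
    moreover have "clique (insert I (intervals h)) (insert I K)"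
      using K(1) \<open>x \<in> I\<close> by (auto simp: clique_def adjacent_def pairwise_def)
    ultimately show False
      using legal by (auto simp: legal_interval_def)
  qed
  \<comment> \<open>If \<open>J\<close> meets \<open>I\<close> but misses \<open>b\<close>, it ends
    before \<open>b\<close>. Not lying inside \<open>I\<close>, it must then start before
    \<open>a\<close>, and so it covers \<open>a\<close>.\<close>
  have "{J \<in> intervals h. I \<inter> J \<noteq> {}} \<subseteq> {J \<in> intervals h. a \<in> J} \<union> {J \<in> intervals h. b \<in> J}"
  proof safe
    fix J y assume J: "J \<in> intervals h" "y \<in> I" "y \<in> J" "b \<notin> J"
    then obtain c d where "J = {c..d}" "c \<le> d"
      using closed[OF J(1)] by (auto simp: closed_interval_def)
    moreover have "\<not> J \<subseteq> I"
      using legal J(1) by (auto simp: legal_interval_def)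
    ultimately show "a \<in> J"
      using J I by auto
  qed
  then have "card {J \<in> intervals h. I \<inter> J \<noteq> {}}
      \<le> card ({J \<in> intervals h. a \<in> J} \<union> {J \<in> intervals h. b \<in> J})"
    by (rule card_mono[rotated]) simp
  also have "\<dots> \<le> card {J \<in> intervals h. a \<in> J} + card {J \<in> intervals h. b \<in> J}"
    by (rule card_Un_le)
  also have "\<dots> \<le> 2 * (\<omega> - 1)"
    using few[of a] few[of b] I by simp
  finally show ?thesis .
qed

text \<open>Pigeonhole on the \<open>n + 1\<close> colors up to \<open>n\<close>: injectivity of
  \<open>fst\<close> gives each interval a single round, so the neighbours of \<open>I\<close> block
  at most \<open>n\<close> colors.\<close>

lemma small_legal_color:
  assumes "inj_on fst (set h)" and "card {J \<in> intervals h. I \<inter> J \<noteq> {}} \<le> n"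
  shows "\<exists>c \<le> n. legal_color h I c"
proof -
  let ?N = "{p \<in> set h. I \<inter> fst p \<noteq> {}}"
  have "fst ` ?N = {J \<in> intervals h. I \<inter> J \<noteq> {}}"
    by (auto simp: intervals_def)
  moreover have "inj_on fst ?N"
    using assms(1) by (rule inj_on_subset) auto
  ultimately have "card (snd ` ?N) \<le> n"
    using assms(2) card_image[of fst ?N] card_image_le[of ?N snd] by simp
  then have "card (snd ` ?N) < card {..n}"
    by simp
  then have "\<not> {..n} \<subseteq> snd ` ?N"
    using card_mono[of "snd ` ?N" "{..n}"] by auto
  then obtain c where "c \<le> n" "c \<notin> snd ` ?N"
    by blast
  then have "legal_color h I c"
    unfolding legal_color_def by force
  then show ?thesis
    using \<open>c \<le> n\<close> by blast
qed

text \<open>An arbitrary strategy of Builder is played against an Algorithm that only answers with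
  colors below \<open>2 * \<omega> - 1\<close>. Finiteness of the game makes this play stop, and the
  final position bounds \<open>m\<close>.\<close>

lemma can_force_le:
  assumes "can_force \<omega> m" and "0 < \<omega>"
  shows "m \<le> 2 * \<omega> - 1"
proof -
  obtain \<sigma> where legal: "legal_strategy \<omega> \<sigma>" and fin: "finite_game \<sigma>"
    and force: "\<And>h. reachable \<sigma> h \<Longrightarrow> \<sigma> h = None \<Longrightarrow> m \<le> card (colors h)"
    using assms(1) by (auto simp: can_force_def)
  \<comment> \<open>Distinctness and closedness of the intervals follow from Builder's legality one
    round at a time. They are carried along with the color bound because the two preceding lemmas
    rely on them.\<close>
  define good where "good h \<longleftrightarrow> reachable \<sigma> h \<and> inj_on fst (set h) \<and>
      (\<forall>J \<in> intervals h. closed_interval J) \<and> colors h \<subseteq> {..<2 * \<omega> - 1}" for h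
  have "\<exists>h. good h \<and> \<sigma> h = None"
  proof (rule ccontr)
    assume stuck: "\<not> ?thesis"
    have "\<exists>p. good (h @ [p])" if good: "good h" for h
    proof -
      obtain I where I: "\<sigma> h = Some I"
        using stuck good by fastforce
      with legal good have li: "legal_interval \<omega> h I"
        by (auto simp: legal_strategy_def good_def)
      \<comment> \<open>Since \<open>\<omega>\<close> is positive, \<open>2 * (\<omega> - 1)\<close>
        is the largest color below \<open>2 * \<omega> - 1\<close>.\<close>
      obtain c where c: "c \<le> 2 * (\<omega> - 1)" "legal_color h I c"
        using small_legal_color few_neighbours[OF li _ \<open>0 < \<omega>\<close>] good unfolding good_def by blast
      have "reachable \<sigma> (h @ [(I, c)])"
        using good I c by (auto simp: good_def intro: reachable.round)
      moreover have "I \<notin> intervals h" "closed_interval I"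
        using li by (auto simp: legal_interval_def)
      ultimately have "good (h @ [(I, c)])"
        using good c(1) \<open>0 < \<omega>\<close> by (auto simp: good_def intervals_def colors_def)
      then show ?thesis ..
    qed
    then obtain next_round where step: "\<And>h. good h \<Longrightarrow> good (h @ [next_round h])"
      by metis
    \<comment> \<open>\<open>finite_game\<close> excludes one infinite sequence of rounds, so the
      nested positions \<open>H n\<close> are built first; the sequence consists of the rounds
      appended to them.\<close>
    define H where "H = rec_nat [] (\<lambda>_ h. h @ [next_round h])"
    have H: "H 0 = []" "\<And>n. H (Suc n) = H n @ [next_round (H n)]"
      by (simp_all add: H_def)
    have "good (H n)" for n
    proof (induction n)
      case 0
      then show ?case by (simp add: H good_def intervals_def colors_def reachable.start)
    qed (simp add: H step)
    moreover have "map (\<lambda>n. next_round (H n)) [0..<n] = H n" for n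
      by (induction n) (simp_all add: H)
    ultimately have "\<forall>n. reachable \<sigma> (map (\<lambda>n. next_round (H n)) [0..<n])"
      by (simp add: good_def)
    with fin show False
      unfolding finite_game_def by blast
  qed
  then obtain h where "good h" "\<sigma> h = None"
    by blast
  with force have "m \<le> card (colors h)" "colors h \<subseteq> {..<2 * \<omega> - 1}"
    by (auto simp: good_def)
  then show ?thesis
    using card_mono[of "{..<2 * \<omega> - 1}" "colors h"] by simp
qed

section \<open>From a bounded game tree to a strategy\<close>

text \<open>Backward induction on a game cut off after \<open>n\<close> more rounds: alternating
  quantifiers take the place of strategies. Positions with enough colors win at once, so
  \<open>n\<close> is only an upper bound on the rounds needed.\<close>

fun wins :: "nat \<Rightarrow> nat \<Rightarrow> nat \<Rightarrow> position \<Rightarrow> bool" where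
  "wins \<omega> m 0 h \<longleftrightarrow> m \<le> card (colors h)"
| "wins \<omega> m (Suc n) h \<longleftrightarrow> m \<le> card (colors h) \<or>
     (\<exists>I. legal_interval \<omega> h I \<and> (\<forall>c. legal_color h I c \<longrightarrow> wins \<omega> m n (h @ [(I, c)])))"

lemma wins_Suc: "wins \<omega> m n h \<Longrightarrow> wins \<omega> m (Suc n) h"
proof (induction n arbitrary: h)
  case (Suc n)
  then show ?case
    unfolding wins.simps(2) by blast
qed simp

lemma wins_mono: "wins \<omega> m n h \<Longrightarrow> n \<le> n' \<Longrightarrow> wins \<omega> m n' h"
proof (induction n' rule: nat_induct)
  case (Suc n')
  then show ?case
    using wins_Suc le_Suc_eq by blast
qed simp

text \<open>Builder always picks a move after which every answer leaves a winning position. The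
  number of rounds left is \<open>N - length h\<close>, so the choice depends on the position alone,
  as a strategy requires.\<close>

lemma can_force_if_wins:
  assumes "wins \<omega> m N []"
  shows "can_force \<omega> m"
proof -
  define good where "good h I \<longleftrightarrow> legal_interval \<omega> h I \<and>
      (\<forall>c. legal_color h I c \<longrightarrow> wins \<omega> m (N - Suc (length h)) (h @ [(I, c)]))" for h I
  define \<sigma> :: strategy where
    "\<sigma> h = (if m \<le> card (colors h) then None else Some (SOME I. good h I))" for h
  have \<sigma>_good: "length h < N \<and> good h I"
    if "wins \<omega> m (N - length h) h" "\<sigma> h = Some I" for h I
  proof -
    have "\<not> m \<le> card (colors h)"
      using that(2) by (auto simp: \<sigma>_def)
    \<comment> \<open>With no rounds left, winning would mean that \<open>m\<close> colors are
      already present, where \<open>\<sigma>\<close> stops.\<close>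
    moreover from this have "N - length h \<noteq> 0"
      using that(1) by (intro notI) simp
    then have "N - length h = Suc (N - Suc (length h))"
      by simp
    ultimately have "\<exists>I. good h I"
      using that(1) by (simp add: good_def)
    then have "good h (SOME I. good h I)"
      by (rule someI_ex)
    then show ?thesis
      using that(2) \<open>N - length h \<noteq> 0\<close> by (auto simp: \<sigma>_def split: if_splits)
  qed
  have reach: "wins \<omega> m (N - length h) h \<and> length h \<le> N" if "reachable \<sigma> h" for h
    using that
  proof induction
    case start
    then show ?case using assms by simp
  next
    case (round h I c)
    then show ?case
      using \<sigma>_good[of h I] by (simp add: good_def)
  qed
  have "legal_strategy \<omega> \<sigma>"
    using reach \<sigma>_good by (auto simp: legal_strategy_def good_def)
  moreover have "finite_game \<sigma>"
    unfolding finite_game_def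
  proof
    \<comment> \<open>A prefix of length \<open>N + 1\<close> contradicts the length bound in
      \<open>reach\<close>.\<close>
    assume "\<exists>p. \<forall>n. reachable \<sigma> (map p [0..<n])"
    then obtain p where "reachable \<sigma> (map p [0..<Suc N])"
      by blast
    from reach[OF this] show False
      by simp
  qed
  moreover have "m \<le> card (colors h)" if "\<sigma> h = None" for h
    using that by (simp add: \<sigma>_def split: if_splits)
  ultimately show ?thesis
    by (auto simp: can_force_def)
qed

section \<open>Checking a strategy tree\<close>

text \<open>In \<open>Node a b ts\<close> Builder presents \<open>[a, b]\<close>, and \<open>ts\<close> holds one continuation for each color that
  Algorithm may answer with, in increasing order.  Colors are numbered in the order of their first
  use, so that \<open>f\<close> used colors are \<open>0, \<dots>, f - 1\<close> and all unused ones are represented by \<open>f\<close>; there is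
  no continuation for a color beyond the first \<open>m\<close>, because Builder has then forced \<open>m + 1\<close> colors.\<close>

datatype tree = Node int int "tree list"

type_synonym board = "(int \<times> int \<times> nat) list"

definition neighbours :: "int \<Rightarrow> int \<Rightarrow> board \<Rightarrow> board" where
  "neighbours a b s = filter (\<lambda>(x, y, c). x \<le> b \<and> a \<le> y) s"

text \<open>Intended for a board that holds only neighbours of \<open>[a, b]\<close>: then all
  tested points lie in \<open>[a, b]\<close>. The bound \<open>< \<omega>\<close> is strict because
  the new interval passes through these points as well.\<close>

definition admissible :: "nat \<Rightarrow> int \<Rightarrow> int \<Rightarrow> board \<Rightarrow> bool" where
  "admissible \<omega> a b s \<longleftrightarrow> a \<le> b \<and>
     list_all (\<lambda>(x, y, c). x < a \<and> y < b \<or> a < x \<and> b < y) s \<and>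
     list_all (\<lambda>z. length (filter (\<lambda>(x, y, c). x \<le> z \<and> z \<le> y) s) < \<omega>)
       (a # filter (\<lambda>x. a \<le> x) (map fst s))"

definition free_colors :: "nat \<Rightarrow> board \<Rightarrow> nat list" where
  "free_colors n s = filter (\<lambda>c. \<not> list_ex (\<lambda>(x, y, d). c = d) s) [0..<n]"

text \<open>The lambda lets \<open>f\<close> and \<open>s\<close> vary while the recursion passes
  through \<open>map\<close>. \<open>list_all2\<close> also compares lengths, so each free color has
  exactly one subtree. On boards grown from the empty one, color \<open>f\<close> is always free
  while \<open>f < m\<close>; an empty list of subtrees thus means that \<open>m\<close> colors are
  in use and all of them occur among the neighbours.\<close>

primrec forces :: "nat \<Rightarrow> nat \<Rightarrow> tree \<Rightarrow> nat \<Rightarrow> board \<Rightarrow> bool" where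
  "forces \<omega> m (Node a b ts) = (\<lambda>f s.
     admissible \<omega> a b (neighbours a b s) \<and>
     list_all2 (\<lambda>c check. check (max f (Suc c)) ((a, b, c) # s))
       (free_colors (min m (Suc f)) (neighbours a b s)) (map (forces \<omega> m) ts))"

section \<open>Soundness: integer boards and real positions\<close>

abbreviation real_interval :: "int \<Rightarrow> int \<Rightarrow> real set" where
  "real_interval a b \<equiv> {real_of_int a..real_of_int b}"

lemma real_intervals_meet:
  "a \<le> b \<Longrightarrow> x \<le> y \<Longrightarrow> real_interval a b \<inter> real_interval x y \<noteq> {} \<longleftrightarrow> x \<le> b \<and> a \<le> y"
  by auto

text \<open>\<open>\<rho>\<close> translates the numbering of the colors on the board into the colors actually played.\<close>

definition realizes :: "nat \<Rightarrow> nat \<Rightarrow> board \<Rightarrow> (nat \<Rightarrow> color) \<Rightarrow> position \<Rightarrow> bool" where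
  "realizes \<omega> f s \<rho> h \<longleftrightarrow>
     set h = (\<lambda>(a, b, c). (real_interval a b, \<rho> c)) ` set s \<and>
     inj_on \<rho> {..<f} \<and> (\<lambda>(a, b, c). c) ` set s = {..<f} \<and>
     (\<forall>(a, b, c) \<in> set s. a \<le> b) \<and>
     \<not> (\<exists>K. clique (intervals h) K \<and> card K = \<omega> + 1)"

text \<open>By Helly's theorem on the line the members of a clique share a point, namely their largest
  left endpoint, so it suffices to count the intervals through left endpoints inside the new one.\<close>

lemma admissible_legal:
  assumes adm: "admissible \<omega> a b (neighbours a b s)" and real: "realizes \<omega> f s \<rho> h"
  shows "legal_interval \<omega> h (real_interval a b)"
proof -
  let ?I = "real_interval a b"
  let ?V = "(\<lambda>(a, b, c). real_interval a b) ` set s"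
  let ?through = "\<lambda>z. filter (\<lambda>(x, y, c). x \<le> z \<and> z \<le> y) (neighbours a b s)"
  have ab: "a \<le> b"
    using adm by (simp add: admissible_def)
  have V: "intervals h = ?V"
    using real by (auto simp: realizes_def intervals_def image_image split_def)
  have s: "x \<le> y" if "(x, y, c) \<in> set s" for x y c
    using real that by (auto simp: realizes_def)
  have apart: "\<not> ?I \<subseteq> J \<and> \<not> J \<subseteq> ?I" if J_in: "J \<in> intervals h" for J
  proof -
    obtain x y c where J: "(x, y, c) \<in> set s" "J = real_interval x y"
      using J_in unfolding V by (auto simp del: Icc_eq_Icc)
    show ?thesis
    proof (cases "x \<le> b \<and> a \<le> y")
      case True
      then have "x < a \<and> y < b \<or> a < x \<and> b < y"
        using adm J(1) by (force simp: admissible_def neighbours_def list_all_iff)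
      then show ?thesis
        using J(2) s[OF J(1)] ab by auto
    next
      case False
      then show ?thesis
        using J(2) s[OF J(1)] ab by auto
    qed
  qed
  have no_clique: False if K: "clique (insert ?I (intervals h)) K" and card: "card K = \<omega> + 1" for K
  proof -
    have meet: "J \<inter> J' \<noteq> {}" if "J \<in> K" "J' \<in> K" "J \<noteq> J'" for J J'
      using K that by (auto simp: clique_def pairwise_def adjacent_def)
    \<comment> \<open>The old position is free of such cliques by \<open>realizes\<close>, so an
      offending clique must involve the new interval.\<close>
    have "?I \<in> K"
    proof (rule ccontr)
      assume "?I \<notin> K"
      then have "clique (intervals h) K"
        using K by (auto simp: clique_def)
      then show False
        using real card by (auto simp: realizes_def)
    qed
    \<comment> \<open>\<open>K\<close> consists of sets of reals while the check works with integer
      endpoints; \<open>S\<close> recovers the endpoint pairs of the old members of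
      \<open>K\<close>.\<close>
    define S where "S = {p \<in> (\<lambda>(x, y, c). (x, y)) ` set s. (\<lambda>(x, y). real_interval x y) p \<in> K - {?I}}"
    have S: "(x, y) \<in> S \<longleftrightarrow> real_interval x y \<in> K - {?I} \<and> (\<exists>c. (x, y, c) \<in> set s)" for x y
      unfolding S_def by force
    have fin: "finite S"
      by (simp add: S_def)
    have K_sub: "\<exists>x y. (x, y) \<in> S \<and> J = real_interval x y" if "J \<in> K - {?I}" for J
    proof -
      have "J \<in> ?V"
        using K V that by (auto simp: clique_def)
      then obtain x y c where "(x, y, c) \<in> set s" "J = real_interval x y"
        by (auto simp del: Icc_eq_Icc)
      then show ?thesis
        using that S by blast
    qed
    \<comment> \<open>The Helly point; \<open>a\<close> is inserted as the left endpoint of the new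
      interval.\<close>
    define z where "z = Max (insert a (fst ` S))"
    have z_in: "z \<in> insert a (fst ` S)"
      unfolding z_def using fin by (intro Max_in) auto
    have z_ge: "a \<le> z" "\<And>x y. (x, y) \<in> S \<Longrightarrow> x \<le> z"
      unfolding z_def using fin by (force intro: Max_ge)+
    have S_near: "x \<le> b \<and> a \<le> y" if "(x, y) \<in> S" for x y
      using that s ab meet[OF \<open>?I \<in> K\<close>, of "real_interval x y"] real_intervals_meet[of a b x y]
      by (auto simp: S)
    \<comment> \<open>The interval must reach the member of \<open>K\<close> that starts at
      \<open>z\<close>. Clique members are known to meet only if they differ, hence the separate
      case of equal intervals.\<close>
    have S_z: "z \<le> y" if xy: "(x, y) \<in> S" for x y
    proof (cases "z = a")
      case True
      then show ?thesis using S_near[OF xy] by simp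
    next
      case False
      then obtain y' where y': "(z, y') \<in> S"
        using z_in by auto
      show ?thesis
      proof (cases "real_interval x y = real_interval z y'")
        case True
        then show ?thesis
          using xy y' s by (auto simp: S)
      next
        case False
        then have "real_interval x y \<inter> real_interval z y' \<noteq> {}"
          using xy y' by (intro meet) (auto simp: S)
        then show ?thesis by auto
      qed
    qed
    \<comment> \<open>All \<open>\<omega>\<close> old members of \<open>K\<close> pass through
      \<open>z\<close>, whereas the check allows fewer than \<open>\<omega>\<close> there.\<close>
    have "\<omega> = card (K - {?I})"
      using card \<open>?I \<in> K\<close> by simp
    also have "\<dots> \<le> card ((\<lambda>(x, y, c). real_interval x y) ` set (?through z))"
    proof (rule card_mono)
      show "K - {?I} \<subseteq> (\<lambda>(x, y, c). real_interval x y) ` set (?through z)"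
      proof
        fix J assume "J \<in> K - {?I}"
        then obtain x y where J: "J = real_interval x y" "(x, y) \<in> S"
          using K_sub by blast
        then obtain c where "(x, y, c) \<in> set s"
          by (auto simp: S)
        then have "(x, y, c) \<in> set (?through z)"
          using J(2) S_near S_z z_ge by (auto simp: neighbours_def)
        then show "J \<in> (\<lambda>(x, y, c). real_interval x y) ` set (?through z)"
          using J(1) by force
      qed
    qed simp
    also have "\<dots> \<le> length (?through z)"
      by (rule order_trans[OF card_image_le card_length]) simp
    also have "\<dots> < \<omega>"
    proof -
      \<comment> \<open>The check covers \<open>z\<close>: it is \<open>a\<close> or the left
        endpoint of a neighbour, and at least \<open>a\<close>.\<close>
      have "z = a \<or> z \<in> set (filter (\<lambda>x. a \<le> x) (map fst (neighbours a b s)))"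
      proof (cases "z = a")
        case False
        then obtain y where "(z, y) \<in> S"
          using z_in by auto
        moreover from this obtain c where "(z, y, c) \<in> set s"
          using S by blast
        ultimately have "(z, y, c) \<in> set (neighbours a b s)"
          using S_near by (auto simp: neighbours_def)
        then show ?thesis
          using z_ge by force
      qed simp
      then show ?thesis
        using adm unfolding admissible_def list_all_iff by auto
    qed
    finally show False by simp
  qed
  show ?thesis
    using ab apart no_clique by (auto simp: legal_interval_def closed_interval_def)
qed

text \<open>Structural induction on the tree, with \<open>\<rho>\<close> extended whenever Algorithm
  uses a fresh color. The size of the tree is a crude but sufficient bound on its depth, that is, on
  the number of rounds.\<close>

lemma forces_wins:
  assumes "forces \<omega> m t f s" and "realizes \<omega> f s \<rho> h"
  shows "wins \<omega> (Suc m) (size t) h"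
  using assms
proof (induction t arbitrary: f s \<rho> h)
  case (Node a b ts)
  let ?I = "real_interval a b" and ?N = "neighbours a b s"
  let ?cs = "free_colors (min m (Suc f)) ?N"
  have adm: "admissible \<omega> a b ?N"
    using Node.prems(1) by simp
  then have ab: "a \<le> b"
    by (simp add: admissible_def)
  have h: "set h = (\<lambda>(a, b, c). (real_interval a b, \<rho> c)) ` set s"
    and inj: "inj_on \<rho> {..<f}" and used: "(\<lambda>(a, b, c). c) ` set s = {..<f}"
    and s: "\<And>x y c. (x, y, c) \<in> set s \<Longrightarrow> x \<le> y"
    using Node.prems(2) by (auto simp: realizes_def)
  have used_lt: "d < f" if "(x, y, d) \<in> set s" for x y d
    using used that by force
  have legal: "legal_interval \<omega> h ?I"
    using adm Node.prems(2) by (rule admissible_legal)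
  have colors_h: "colors h = \<rho> ` {..<f}"
    unfolding colors_def h used[symmetric] by (force simp: image_image)
  \<comment> \<open>A separate \<open>\<rho>'\<close> treats both kinds of answer at once: it is
    \<open>\<rho>\<close> for an old color and \<open>\<rho>(f := c)\<close> for a fresh
    one.\<close>
  have branch: "wins \<omega> (Suc m) (size_list size ts) (h @ [(?I, \<rho>' c)])"
    if c: "c < m" "c \<le> f" and lc: "legal_color h ?I (\<rho>' c)"
      and \<rho>': "\<And>d. d < f \<Longrightarrow> \<rho>' d = \<rho> d" "inj_on \<rho>' {..<max f (Suc c)}" for \<rho>' c
  proof -
    have "c \<in> set ?cs"
    proof -
      \<comment> \<open>If a neighbour carried the number \<open>c\<close>, its actual color would
        be \<open>\<rho>' c\<close>, and the answer would be illegal.\<close>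
      have "c \<noteq> d" if "(x, y, d) \<in> set ?N" for x y d
      proof -
        have xyd: "(x, y, d) \<in> set s" "x \<le> b" "a \<le> y"
          using that by (auto simp: neighbours_def)
        then have "(real_interval x y, \<rho> d) \<in> set h"
          unfolding h by force
        then have "\<rho>' c \<noteq> \<rho> d"
          using lc xyd real_intervals_meet[OF ab s[OF xyd(1)]] unfolding legal_color_def by fastforce
        then show ?thesis
          using \<rho>'(1) used_lt[OF xyd(1)] by auto
      qed
      then show ?thesis
        using c by (auto simp: free_colors_def list_ex_iff)
    qed
    then obtain i where i: "i < length ?cs" "?cs ! i = c"
      by (auto simp: in_set_conv_nth)
    then have "i < length ts" and t: "forces \<omega> m (ts ! i) (max f (Suc c)) ((a, b, c) # s)"
      using Node.prems(1) by (auto simp: list_all2_conv_all_nth)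
    then have ti: "ts ! i \<in> set ts"
      by simp
    have "realizes \<omega> (max f (Suc c)) ((a, b, c) # s) \<rho>' (h @ [(?I, \<rho>' c)])"
      unfolding realizes_def
    proof (intro conjI)
      have "(\<lambda>(a, b, c). (real_interval a b, \<rho> c)) ` set s
          = (\<lambda>(a, b, c). (real_interval a b, \<rho>' c)) ` set s"
        using used_lt \<rho>'(1) by (intro image_cong refl) auto
      then show "set (h @ [(?I, \<rho>' c)])
          = (\<lambda>(a, b, c). (real_interval a b, \<rho>' c)) ` set ((a, b, c) # s)"
        using h by auto
      show "(\<lambda>(a, b, c). c) ` set ((a, b, c) # s) = {..<max f (Suc c)}"
        using used c(2) by auto
      show "\<not> (\<exists>K. clique (intervals (h @ [(?I, \<rho>' c)])) K \<and> card K = \<omega> + 1)"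
        using legal by (simp add: legal_interval_def intervals_def)
    qed (use \<rho>'(2) s ab in auto)
    then have "wins \<omega> (Suc m) (size (ts ! i)) (h @ [(?I, \<rho>' c)])"
      by (rule Node.IH[OF ti t])
    then show ?thesis
      \<comment> \<open>The subtrees differ in size; the sum of their sizes serves as a common
        bound.\<close>
      by (rule wins_mono) (use ti in \<open>simp add: size_list_estimation'\<close>)
  qed
  have "wins \<omega> (Suc m) (size_list size ts) (h @ [(?I, c)])" if lc: "legal_color h ?I c" for c
  proof (cases "c \<in> \<rho> ` {..<f}")
    case True
    then obtain d where d: "c = \<rho> d" "d < f"
      by auto
    show ?thesis
    proof (cases "d < m")
      case True
      then show ?thesis
        using branch[of d \<rho>] d lc inj by (simp add: max_absorb1)
    next
      case False
      \<comment> \<open>From \<open>m \<le> d < f\<close> there are already at least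
        \<open>m + 1\<close> colors in use, so this answer needs no subtree.\<close>
      then have "Suc m \<le> card (colors h)"
        using d(2) inj by (simp add: colors_h card_image)
      also have "\<dots> \<le> card (colors (h @ [(?I, c)]))"
        by (rule card_mono) (auto simp: colors_def)
      finally show ?thesis
        by (cases "size_list size ts") simp_all
    qed
  next
    case new: False
    show ?thesis
    proof (cases "f < m")
      case True
      have "inj_on (\<rho>(f := c)) {..<Suc f}"
        using inj new by (auto simp: lessThan_Suc inj_on_def)
      then show ?thesis
        using branch[of f "\<rho>(f := c)"] True lc by simp
    next
      case False
      \<comment> \<open>At least \<open>m\<close> colors were in use, and the fresh one raises the
        count to at least \<open>m + 1\<close>.\<close>
      have "colors (h @ [(?I, c)]) = insert c (\<rho> ` {..<f})"
        using colors_h by (auto simp: colors_def)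
      then have "Suc m \<le> card (colors (h @ [(?I, c)]))"
        using False new inj by (simp add: card_image)
      then show ?thesis
        by (cases "size_list size ts") simp_all
    qed
  qed
  then show ?case
    using legal by auto
qed

lemma can_force_if_forces:
  assumes "forces \<omega> m t 0 []"
  shows "can_force \<omega> (Suc m)"
proof -
  have "realizes \<omega> 0 [] id []"
    by (auto simp: realizes_def intervals_def clique_def)
  then show ?thesis
    using forces_wins[OF assms] can_force_if_wins by blast
qed

section \<open>A strategy forcing seven colors\<close>

text \<open>The tree was found by proof-number search over the orders of the endpoints.  Its coordinates
  leave exactly the room that later rounds need between earlier endpoints.\<close>

definition strategy_tree :: tree where
  "strategy_tree =
    Node 10 30 [ Node 23 43 [ Node 57 77 [ Node 5 16 [ Node 7 20 [ Node 37 61 [ Node 33 59 [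
    Node 6 18 [ Node 31 58 [ Node 17 32 [ Node 19 34 []]], Node 35 60 [ Node 17 34 [
    Node 19 36 []], Node 17 36 []]]], Node 8 22 [ Node 33 59 [ Node 31 58 [ Node 17 32 [
    Node 21 34 []]], Node 35 60 [ Node 17 34 [ Node 21 36 []], Node 17 36 []]], Node 41 63 [
    Node 21 42 [ Node 17 38 []], Node 39 62 [ Node 17 38 [ Node 21 40 []], Node 17 40 []],
    Node 17 42 []]]]], Node 3 12 [ Node 37 61 [ Node 33 59 [ Node 4 14 [ Node 31 58 [ Node 13 32 [
    Node 15 34 []]], Node 35 60 [ Node 13 34 [ Node 15 36 []], Node 13 36 []]]], Node 6 18 [
    Node 33 59 [ Node 31 58 [ Node 13 32 [ Node 17 34 []]], Node 35 60 [ Node 13 34 [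
    Node 17 36 []], Node 13 36 []]], Node 41 63 [ Node 17 42 [ Node 13 38 []], Node 39 62 [
    Node 13 38 [ Node 17 40 []], Node 13 40 []], Node 13 42 []]]], Node 37 61 [ Node 33 59 [
    Node 11 32 [ Node 31 58 [ Node 13 34 []]], Node 35 60 [ Node 11 34 [ Node 13 36 []],
    Node 11 36 []]], Node 41 63 [ Node 11 32 [ Node 31 58 [ Node 13 38 []]], Node 1 7 [ Node 2 9 [
    Node 13 38 [ Node 39 62 [ Node 8 18 [ Node 17 40 []], Node 14 40 []], Node 14 42 []],
    Node 13 42 [ Node 8 24 []], Node 13 38 [ Node 8 24 [], Node 14 42 []]], Node 4 14 [
    Node 15 42 [ Node 13 38 []], Node 13 42 []], Node 13 42 [ Node 6 24 []], Node 13 38 [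
    Node 6 24 [], Node 14 42 []]]], Node 41 63 [ Node 39 62 [ Node 11 38 [ Node 13 40 []],
    Node 11 40 []], Node 11 38 [ Node 13 42 []], Node 11 42 []]]]], Node 37 56 [ Node 12 34 [
    Node 50 61 [ Node 46 59 [ Node 11 32 [ Node 44 58 [ Node 31 45 [ Node 33 47 []]], Node 48 60 [
    Node 31 47 [ Node 33 49 []], Node 31 49 []]]], Node 13 36 [ Node 46 59 [ Node 44 58 [
    Node 31 45 [ Node 35 47 []]], Node 48 60 [ Node 31 47 [ Node 35 49 []], Node 31 49 []]],
    Node 54 63 [ Node 35 55 [ Node 31 51 []], Node 52 62 [ Node 31 51 [ Node 35 53 []],
    Node 31 53 []], Node 31 55 []]]]], Node 3 25 [ Node 50 61 [ Node 46 59 [ Node 4 27 [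
    Node 44 58 [ Node 26 45 [ Node 28 47 []]], Node 48 60 [ Node 26 47 [ Node 28 49 []],
    Node 26 49 []]]], Node 11 32 [ Node 46 59 [ Node 44 58 [ Node 26 45 [ Node 31 47 []]],
    Node 48 60 [ Node 26 47 [ Node 31 49 []], Node 26 49 []]], Node 54 63 [ Node 31 55 [
    Node 26 51 []], Node 52 62 [ Node 26 51 [ Node 31 53 []], Node 26 53 []], Node 26 55 []]]],
    Node 50 61 [ Node 46 59 [ Node 24 45 [ Node 44 58 [ Node 26 47 []]], Node 48 60 [ Node 24 47 [
    Node 26 49 []], Node 24 49 []]], Node 54 63 [ Node 24 45 [ Node 44 58 [ Node 26 51 []]],
    Node 1 12 [ Node 2 14 [ Node 26 51 [ Node 52 62 [ Node 13 32 [ Node 31 53 []], Node 27 53 []],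
    Node 27 55 []], Node 26 55 [ Node 13 38 []], Node 26 51 [ Node 13 38 [], Node 27 55 []]],
    Node 4 27 [ Node 28 55 [ Node 26 51 []], Node 26 55 []], Node 26 55 [ Node 11 38 []],
    Node 26 51 [ Node 11 38 [], Node 27 55 []]]], Node 54 63 [ Node 52 62 [ Node 24 51 [
    Node 26 53 []], Node 24 53 []], Node 24 51 [ Node 26 55 []], Node 24 55 []]]]], Node 28 62 [
    Node 118 138 [ Node 132 146 [ Node 136 148 [ Node 134 147 [ Node 29 64 [ Node 63 135 [
    Node 58 133 []]], Node 24 59 [ Node 60 135 [ Node 58 133 []], Node 58 135 []]], Node 63 137 [
    Node 29 64 [ Node 58 133 []]], Node 24 59 [ Node 60 137 [ Node 58 133 []], Node 58 137 []]],
    Node 70 122 [ Node 120 139 [ Node 29 64 [ Node 63 121 [ Node 58 119 []]], Node 24 59 [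
    Node 60 121 [ Node 58 119 []], Node 58 121 []]], Node 31 67 [ Node 80 134 [ Node 63 81 [
    Node 32 69 [ Node 68 119 []]], Node 29 64 [ Node 78 133 [ Node 65 81 [ Node 63 79 []],
    Node 65 81 [ Node 63 79 []]], Node 82 135 [ Node 63 83 [], Node 65 83 [ Node 63 81 []]]]],
    Node 65 120 [ Node 63 119 [ Node 29 64 []], Node 29 66 []]], Node 120 139 [ Node 29 71 [
    Node 58 121 []], Node 72 123 [ Node 29 71 [ Node 58 119 []], Node 29 73 []], Node 58 119 [
    Node 59 121 [], Node 29 71 []]]], Node 65 134 [ Node 63 133 [ Node 29 64 [ Node 58 119 []]],
    Node 67 135 [ Node 29 66 [ Node 58 119 []], Node 29 68 []]], Node 128 144 [ Node 24 59 [
    Node 60 133 [ Node 58 129 []], Node 58 133 []], Node 70 122 [ Node 120 139 [ Node 29 64 [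
    Node 63 121 [ Node 58 119 []], Node 58 119 [ Node 63 121 []]], Node 24 59 [ Node 58 121 [],
    Node 58 119 [ Node 60 121 []]]], Node 31 67 [ Node 64 81 [ Node 63 79 [ Node 80 133 [
    Node 78 129 []], Node 78 133 []], Node 32 69 [ Node 120 139 [ Node 68 121 [], Node 68 119 [
    Node 78 129 []]]], Node 68 119 [ Node 78 133 [], Node 32 69 []]], Node 65 120 [ Node 63 119 [
    Node 29 64 []], Node 29 66 []], Node 65 120 [ Node 63 119 [ Node 29 64 []], Node 29 66 []]],
    Node 120 139 [ Node 29 71 [ Node 58 121 []], Node 72 123 [ Node 29 71 [ Node 58 119 []],
    Node 29 73 []], Node 58 119 [ Node 59 121 [], Node 29 71 []]], Node 120 139 [ Node 29 71 [
    Node 58 121 []], Node 72 123 [ Node 29 71 [ Node 58 119 []], Node 29 73 []]]], Node 58 119 [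
    Node 29 64 [ Node 65 133 [ Node 63 129 []], Node 63 133 []], Node 65 133 [ Node 29 64 [
    Node 63 129 []], Node 29 66 []], Node 65 133 [ Node 29 64 [ Node 63 129 []]]], Node 31 67 [
    Node 71 122 [ Node 63 80 [ Node 72 133 [], Node 120 139 [ Node 68 119 [ Node 78 129 [],
    Node 32 69 []], Node 72 129 []], Node 120 139 [ Node 78 123 [ Node 32 69 [ Node 68 119 []],
    Node 58 79 []], Node 32 69 [ Node 68 121 []]]], Node 142 148 [ Node 140 147 [ Node 32 73 [
    Node 72 129 [ Node 74 133 []], Node 63 79 [ Node 74 133 [], Node 78 130 [ Node 74 129 [],
    Node 119 141 []]]], Node 32 73 [ Node 72 129 [ Node 74 133 []], Node 63 78 [ Node 74 133 [],
    Node 74 129 [ Node 119 141 []]]], Node 63 79 [ Node 72 133 [], Node 32 69 [ Node 120 139 [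
    Node 68 121 [], Node 68 119 [ Node 78 129 []]]], Node 78 125 [ Node 32 69 [ Node 68 119 []],
    Node 64 81 [ Node 80 133 [], Node 80 129 [ Node 123 141 []]], Node 123 141 [ Node 72 124 [],
    Node 64 81 [ Node 80 129 []]]]]], Node 32 73 [ Node 74 133 [ Node 72 129 []], Node 63 79 [
    Node 74 133 [], Node 78 130 [ Node 74 129 [], Node 119 143 []]]], Node 68 119 [
    Node 72 133 [], Node 120 143 [ Node 72 129 []], Node 69 121 [ Node 120 143 [],
    Node 32 70 []]], Node 32 73 [ Node 74 133 [ Node 72 129 []], Node 63 79 [ Node 74 133 [],
    Node 130 145 [ Node 74 131 [], Node 74 129 [ Node 78 131 []]]]]], Node 74 125 [ Node 123 139 [
    Node 63 79 [ Node 78 129 [], Node 32 72 []], Node 75 129 []], Node 32 73 [ Node 123 139 [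
    Node 72 124 [], Node 63 79 [ Node 78 129 []]]], Node 32 75 []], Node 124 139 [ Node 74 126 [
    Node 32 73 [ Node 72 125 []], Node 32 75 []], Node 80 126 [ Node 73 123 [ Node 32 72 [
    Node 63 81 []], Node 32 74 []], Node 63 81 [ Node 58 79 [ Node 78 125 []], Node 32 72 []],
    Node 82 127 [ Node 58 83 [], Node 58 81 [ Node 63 83 []]]], Node 74 126 [ Node 32 73 [
    Node 72 125 []], Node 32 75 []]]], Node 68 133 [ Node 58 129 [], Node 63 119 [ Node 64 129 [],
    Node 29 64 []]], Node 65 129 [ Node 68 133 [ Node 29 64 [ Node 63 119 []]], Node 68 133 [
    Node 29 64 [ Node 63 119 []]], Node 29 66 []]]]], Node 69 122 [ Node 71 123 [ Node 29 64 [
    Node 63 119 [ Node 31 70 []]], Node 24 58 [ Node 59 119 [ Node 31 70 []], Node 31 72 []]],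
    Node 65 120 [ Node 29 64 [ Node 63 119 [ Node 31 66 []]], Node 67 121 [ Node 29 66 [
    Node 31 68 []], Node 29 68 []]], Node 73 124 [ Node 29 70 [ Node 31 74 []], Node 71 123 [
    Node 29 70 [ Node 31 72 []], Node 29 72 []], Node 29 74 []]], Node 70 90 [ Node 80 121 [
    Node 78 119 [ Node 29 64 [ Node 63 81 [ Node 31 71 []]], Node 24 59 [ Node 60 81 [
    Node 31 71 []], Node 58 81 []]], Node 29 65 [ Node 82 122 [ Node 63 83 [ Node 31 71 []],
    Node 72 119 [ Node 31 71 [ Node 63 81 []], Node 31 73 []], Node 63 81 [ Node 64 83 [],
    Node 31 71 []]]], Node 78 120 [ Node 24 59 [ Node 60 81 [ Node 31 71 []], Node 58 81 []],
    Node 29 65 [ Node 72 119 [ Node 31 71 [ Node 63 79 []], Node 31 73 []], Node 63 79 [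
    Node 64 81 [], Node 31 71 []]], Node 24 59 [ Node 60 81 [ Node 58 79 []], Node 60 79 [
    Node 61 81 [], Node 31 71 []]]]], Node 84 122 [ Node 86 123 [ Node 29 64 [ Node 63 87 [
    Node 58 85 []]], Node 24 59 [ Node 60 87 [ Node 58 85 []], Node 58 87 []]], Node 65 86 [
    Node 63 85 [ Node 31 66 [ Node 29 64 []]], Node 67 87 [ Node 31 68 [ Node 29 66 []],
    Node 29 68 []]], Node 29 64 [ Node 80 120 [ Node 82 121 [ Node 58 81 [ Node 63 83 []],
    Node 58 83 []], Node 78 119 [ Node 58 79 [ Node 63 81 []], Node 58 79 [ Node 63 81 []]],
    Node 82 121 [ Node 58 83 [], Node 58 81 [ Node 63 83 []]]], Node 88 124 [ Node 58 89 [],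
    Node 63 89 [ Node 58 85 []], Node 86 123 [ Node 58 87 [], Node 58 85 [ Node 63 87 []]]]]],
    Node 84 122 [ Node 31 67 [ Node 80 120 [ Node 63 81 [ Node 32 69 [ Node 68 85 []]],
    Node 29 64 [ Node 78 119 [ Node 65 81 [ Node 63 79 []], Node 65 81 [ Node 63 79 []]],
    Node 82 121 [ Node 63 83 [], Node 65 83 [ Node 63 81 []]]]], Node 65 86 [ Node 63 85 [
    Node 29 64 []], Node 29 66 []]], Node 65 86 [ Node 63 85 [ Node 31 66 [ Node 29 64 []]],
    Node 67 87 [ Node 31 68 [ Node 29 66 []], Node 29 68 []]], Node 31 67 [ Node 44 69 [
    Node 88 124 [ Node 68 89 [ Node 63 85 []], Node 86 123 [ Node 63 85 [ Node 68 87 []],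
    Node 63 87 []], Node 63 89 []], Node 80 120 [ Node 78 119 [ Node 63 79 [ Node 68 81 []],
    Node 63 79 [ Node 68 81 []]], Node 82 121 [ Node 63 81 [ Node 68 83 []], Node 63 83 []],
    Node 82 121 [ Node 63 81 [ Node 68 83 []], Node 63 83 []]], Node 88 124 [ Node 68 89 [
    Node 63 85 []], Node 63 89 [], Node 86 123 [ Node 63 85 [ Node 68 87 []], Node 63 87 []]]],
    Node 65 82 [ Node 29 64 [ Node 80 120 [ Node 63 81 [], Node 78 119 [ Node 63 79 []]]],
    Node 29 64 [ Node 80 120 [ Node 63 81 [], Node 78 119 [ Node 63 79 []]]], Node 29 66 []],
    Node 65 81 [ Node 80 120 [ Node 66 85 [], Node 78 119 [ Node 29 64 [ Node 63 79 []]]],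
    Node 80 120 [ Node 66 85 [], Node 78 119 [ Node 29 64 [ Node 63 79 []]]], Node 29 66 []]]],
    Node 82 121 [ Node 84 122 [ Node 29 71 [ Node 58 85 []], Node 72 91 [ Node 29 71 [
    Node 58 83 []], Node 29 73 []], Node 58 83 [ Node 59 85 [], Node 29 71 []]], Node 74 119 [
    Node 29 71 [ Node 31 75 []], Node 72 91 [ Node 29 71 [ Node 31 73 []], Node 29 73 []],
    Node 29 75 []], Node 74 119 [ Node 29 71 [ Node 31 75 []], Node 72 91 [ Node 29 71 [
    Node 31 73 []], Node 29 73 []], Node 29 75 []], Node 80 120 [ Node 58 81 [ Node 59 83 [],
    Node 29 71 []], Node 31 72 [ Node 58 83 [], Node 29 71 []], Node 63 81 [ Node 24 58 [
    Node 78 119 [ Node 31 64 [ Node 59 79 []]], Node 31 71 []], Node 24 59 [ Node 44 65 [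
    Node 64 83 [], Node 78 119 [ Node 60 79 []]], Node 78 119 [ Node 58 79 []]],
    Node 29 71 []]]]], Node 69 122 [ Node 73 124 [ Node 29 64 [ Node 63 119 [ Node 31 70 []]],
    Node 1 25 [ Node 11 32 [ Node 33 74 [ Node 31 70 []], Node 31 74 []], Node 2 27 [ Node 31 70 [
    Node 71 123 [ Node 26 45 [ Node 44 72 []], Node 32 72 []], Node 32 74 []], Node 31 74 [
    Node 26 58 []], Node 31 70 [ Node 26 58 [], Node 32 74 []]], Node 31 74 [ Node 24 58 []],
    Node 31 70 [ Node 24 58 [], Node 32 74 []]]], Node 65 120 [ Node 29 64 [ Node 63 119 [
    Node 31 66 []]], Node 67 121 [ Node 29 66 [ Node 31 68 []], Node 29 68 []]], Node 73 124 [
    Node 29 70 [ Node 31 74 []], Node 71 123 [ Node 29 70 [ Node 31 72 []], Node 29 72 []],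
    Node 29 74 []]], Node 104 126 [ Node 114 132 [ Node 24 59 [ Node 60 119 [ Node 58 115 []],
    Node 58 119 []], Node 70 108 [ Node 106 127 [ Node 29 64 [ Node 63 107 [ Node 58 105 []],
    Node 58 105 [ Node 63 107 []]], Node 24 59 [ Node 58 107 [], Node 58 105 [ Node 60 107 []]]],
    Node 31 67 [ Node 64 81 [ Node 63 79 [ Node 80 119 [ Node 78 115 []], Node 78 119 []],
    Node 32 69 [ Node 106 127 [ Node 68 107 [], Node 68 105 [ Node 78 115 []]]], Node 68 105 [
    Node 78 119 [], Node 32 69 []]], Node 65 106 [ Node 63 105 [ Node 29 64 []], Node 29 66 []],
    Node 65 106 [ Node 63 105 [ Node 29 64 []], Node 29 66 []]], Node 106 127 [ Node 29 71 [
    Node 58 107 []], Node 72 109 [ Node 29 71 [ Node 58 105 []], Node 29 73 []], Node 58 105 [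
    Node 59 107 [], Node 29 71 []]], Node 106 127 [ Node 29 71 [ Node 58 107 []], Node 72 109 [
    Node 29 71 [ Node 58 105 []], Node 29 73 []]]], Node 58 105 [ Node 29 64 [ Node 65 119 [
    Node 63 115 []], Node 63 119 []], Node 65 119 [ Node 29 64 [ Node 63 115 []], Node 29 66 []],
    Node 65 119 [ Node 29 64 [ Node 63 115 []]]], Node 31 67 [ Node 71 108 [ Node 63 80 [
    Node 72 119 [], Node 106 127 [ Node 68 105 [ Node 78 115 [], Node 32 69 []], Node 72 115 []],
    Node 106 127 [ Node 78 109 [ Node 32 69 [ Node 68 105 []], Node 58 79 []], Node 32 69 [
    Node 68 107 []]]], Node 130 140 [ Node 128 139 [ Node 32 73 [ Node 72 115 [ Node 74 119 []],
    Node 63 79 [ Node 74 119 [], Node 78 116 [ Node 74 115 [], Node 105 129 []]]], Node 32 73 [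
    Node 72 115 [ Node 74 119 []], Node 63 78 [ Node 74 119 [], Node 74 115 [ Node 105 129 []]]],
    Node 63 79 [ Node 72 119 [], Node 32 69 [ Node 106 127 [ Node 68 107 [], Node 68 105 [
    Node 78 115 []]]], Node 78 111 [ Node 32 69 [ Node 68 105 []], Node 64 81 [ Node 80 119 [],
    Node 80 115 [ Node 109 129 []]], Node 109 129 [ Node 72 110 [], Node 64 81 [
    Node 80 115 []]]]]], Node 32 73 [ Node 74 119 [ Node 72 115 []], Node 63 79 [ Node 74 119 [],
    Node 78 116 [ Node 74 115 [], Node 105 131 []]]], Node 68 105 [ Node 72 119 [], Node 106 131 [
    Node 72 115 []], Node 69 107 [ Node 106 131 [], Node 32 70 []]], Node 32 73 [ Node 74 119 [
    Node 72 115 []], Node 63 79 [ Node 74 119 [], Node 116 133 [ Node 74 117 [], Node 74 115 [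
    Node 78 117 []]]]]], Node 74 111 [ Node 109 127 [ Node 63 79 [ Node 78 115 [], Node 32 72 []],
    Node 75 115 []], Node 32 73 [ Node 109 127 [ Node 72 110 [], Node 63 79 [ Node 78 115 []]]],
    Node 32 75 []], Node 110 127 [ Node 74 112 [ Node 32 73 [ Node 72 111 []], Node 32 75 []],
    Node 80 112 [ Node 73 109 [ Node 32 72 [ Node 63 81 []], Node 32 74 []], Node 63 81 [
    Node 58 79 [ Node 78 111 []], Node 32 72 []], Node 82 113 [ Node 58 83 [], Node 58 81 [
    Node 63 83 []]]], Node 74 112 [ Node 32 73 [ Node 72 111 []], Node 32 75 []]]], Node 68 119 [
    Node 58 115 [], Node 63 105 [ Node 64 115 [], Node 29 64 []]], Node 65 115 [ Node 68 119 [
    Node 29 64 [ Node 63 105 []]], Node 68 119 [ Node 29 64 [ Node 63 105 []]], Node 29 66 []]]],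
    Node 68 120 [ Node 24 59 [ Node 60 119 [ Node 31 69 []], Node 58 119 []], Node 63 105 [
    Node 29 65 [ Node 66 119 [ Node 31 67 []], Node 64 119 []], Node 65 106 [ Node 29 64 [
    Node 31 66 []], Node 29 66 []], Node 29 64 [ Node 65 119 [ Node 31 66 []]]], Node 58 105 [
    Node 59 119 [], Node 29 69 []]], Node 71 87 [ Node 29 64 [ Node 78 120 [ Node 73 119 [
    Node 31 72 [ Node 63 79 []], Node 31 74 []], Node 73 119 [ Node 31 72 [ Node 63 79 []],
    Node 31 74 []], Node 80 121 [ Node 58 81 [], Node 58 79 [ Node 63 81 []]]], Node 80 120 [
    Node 82 121 [ Node 31 72 [ Node 63 83 []], Node 73 88 [ Node 31 72 [ Node 63 81 []],
    Node 31 74 []]], Node 82 121 [ Node 31 72 [ Node 63 83 []], Node 73 88 [ Node 31 72 [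
    Node 63 81 []], Node 31 74 []]], Node 73 105 [ Node 63 79 [ Node 78 119 [], Node 31 72 []],
    Node 63 79 [ Node 78 119 [], Node 31 72 []], Node 31 74 []]]], Node 80 120 [ Node 82 121 [
    Node 29 64 [ Node 63 83 [ Node 58 81 []], Node 58 81 [ Node 63 83 []]], Node 24 59 [
    Node 58 83 [], Node 58 81 [ Node 60 83 []]]], Node 63 81 [ Node 78 119 [ Node 24 59 [
    Node 58 79 [], Node 31 64 [ Node 60 79 []]]], Node 65 82 [ Node 29 64 [ Node 31 66 []],
    Node 29 66 []], Node 29 64 [ Node 78 119 [ Node 58 79 []]]], Node 78 119 [ Node 24 59 [
    Node 58 81 [], Node 58 79 [ Node 60 81 []]], Node 31 67 [ Node 29 64 [ Node 63 81 [],
    Node 65 81 [ Node 63 79 []]], Node 29 64 [ Node 65 81 [ Node 63 79 []]], Node 65 81 [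
    Node 29 64 [ Node 63 79 []], Node 29 66 []]]]], Node 83 120 [ Node 31 67 [ Node 64 81 [
    Node 63 79 [ Node 80 119 [ Node 78 105 []], Node 78 119 []], Node 32 69 [ Node 85 121 [
    Node 68 86 [], Node 68 84 [ Node 78 105 []]]], Node 68 84 [ Node 78 119 [], Node 32 69 []]],
    Node 65 85 [ Node 63 84 [ Node 29 64 []], Node 29 66 []], Node 65 85 [ Node 63 84 [
    Node 29 64 []], Node 29 66 []]], Node 65 85 [ Node 29 64 [ Node 63 84 [ Node 31 66 []],
    Node 63 84 [ Node 31 66 []]], Node 67 86 [ Node 29 66 [ Node 31 68 []], Node 29 68 []],
    Node 67 86 [ Node 29 66 [ Node 31 68 []], Node 29 68 []]], Node 31 67 [ Node 32 70 [
    Node 85 121 [ Node 63 84 [ Node 68 86 []], Node 63 86 []], Node 69 82 [ Node 68 79 [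
    Node 78 119 [], Node 80 119 [ Node 78 105 []]], Node 80 119 [ Node 63 79 [ Node 78 105 []]],
    Node 80 119 [ Node 63 79 [ Node 78 105 []], Node 63 81 []]]], Node 63 79 [ Node 78 119 [
    Node 64 84 []], Node 78 119 [ Node 64 84 []], Node 29 64 []], Node 65 84 [ Node 63 79 [
    Node 78 119 [], Node 29 64 []], Node 78 119 [ Node 29 64 [ Node 63 79 []]], Node 29 66 []]]],
    Node 75 94 [ Node 31 76 [ Node 29 72 []], Node 78 119 [ Node 29 72 [ Node 58 79 []],
    Node 73 88 [ Node 29 72 [ Node 31 74 []], Node 29 74 []], Node 31 73 [ Node 58 79 [],
    Node 29 72 []]], Node 29 73 [ Node 90 120 [ Node 92 121 [ Node 72 93 [], Node 78 105 [
    Node 72 91 []]], Node 92 121 [ Node 72 93 [], Node 78 105 [ Node 72 91 []]], Node 88 119 [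
    Node 78 105 [ Node 72 89 []], Node 78 105 [ Node 72 89 []]]]], Node 29 76 []], Node 79 120 [
    Node 81 121 [ Node 29 72 [ Node 58 82 []], Node 73 88 [ Node 29 72 [ Node 58 80 []],
    Node 29 74 []]], Node 78 119 [ Node 29 72 [ Node 58 80 []], Node 73 88 [ Node 29 72 [
    Node 31 74 []], Node 29 74 []]], Node 75 119 [ Node 29 72 [ Node 31 76 []], Node 73 88 [
    Node 29 72 [ Node 31 74 []], Node 29 74 []]]]], Node 69 108 [ Node 74 120 [ Node 29 71 [
    Node 72 119 [ Node 31 73 []], Node 70 119 []], Node 1 25 [ Node 11 32 [ Node 31 75 [],
    Node 33 75 [ Node 31 70 []]], Node 2 27 [ Node 31 70 [ Node 32 75 [], Node 71 119 [
    Node 26 45 [ Node 44 72 []]]], Node 31 70 [ Node 32 75 [], Node 26 58 []], Node 31 75 [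
    Node 26 58 []]], Node 31 70 [ Node 32 75 [], Node 24 58 []], Node 24 58 [ Node 31 75 []]]],
    Node 65 106 [ Node 63 105 [ Node 31 66 [ Node 29 64 []], Node 31 66 [ Node 29 64 []]],
    Node 67 107 [ Node 31 68 [ Node 29 66 []], Node 29 68 []], Node 67 107 [ Node 31 68 [
    Node 29 66 []], Node 29 68 []]], Node 73 119 [ Node 29 70 [ Node 31 74 []], Node 71 109 [
    Node 29 70 [ Node 31 72 []], Node 29 72 []], Node 29 74 []], Node 29 70 [ Node 73 120 [
    Node 31 74 [], Node 71 119 [ Node 31 72 []]]]], Node 94 120 [ Node 31 67 [ Node 71 98 [
    Node 63 80 [ Node 72 119 [], Node 96 121 [ Node 68 95 [ Node 78 105 [], Node 32 69 []],
    Node 72 105 []], Node 96 121 [ Node 78 99 [ Node 32 69 [ Node 68 95 []], Node 58 79 []],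
    Node 32 69 [ Node 68 97 []]]], Node 124 140 [ Node 122 139 [ Node 32 73 [ Node 72 105 [
    Node 74 119 []], Node 63 79 [ Node 74 119 [], Node 78 106 [ Node 74 105 [], Node 95 123 []]]],
    Node 32 73 [ Node 72 105 [ Node 74 119 []], Node 63 78 [ Node 74 119 [], Node 74 105 [
    Node 95 123 []]]], Node 63 79 [ Node 72 119 [], Node 32 69 [ Node 96 121 [ Node 68 97 [],
    Node 68 95 [ Node 78 105 []]]], Node 78 101 [ Node 32 69 [ Node 68 95 []], Node 64 81 [
    Node 80 119 [], Node 80 105 [ Node 99 123 []]], Node 99 123 [ Node 72 100 [], Node 64 81 [
    Node 80 105 []]]]]], Node 32 73 [ Node 74 119 [ Node 72 105 []], Node 63 79 [ Node 74 119 [],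
    Node 78 106 [ Node 74 105 [], Node 95 125 []]]], Node 68 95 [ Node 72 119 [], Node 96 125 [
    Node 72 105 []], Node 69 97 [ Node 96 125 [], Node 32 70 []]], Node 32 73 [ Node 74 119 [
    Node 72 105 []], Node 63 79 [ Node 74 119 [], Node 106 127 [ Node 74 107 [], Node 74 105 [
    Node 78 107 []]]]]], Node 74 101 [ Node 99 121 [ Node 63 79 [ Node 78 105 [], Node 32 72 []],
    Node 75 105 []], Node 32 73 [ Node 99 121 [ Node 72 100 [], Node 63 79 [ Node 78 105 []]]],
    Node 32 75 []], Node 100 121 [ Node 74 102 [ Node 32 73 [ Node 72 101 []], Node 32 75 []],
    Node 80 102 [ Node 73 99 [ Node 32 72 [ Node 63 81 []], Node 32 74 []], Node 63 81 [
    Node 58 79 [ Node 78 101 []], Node 32 72 []], Node 82 103 [ Node 58 83 [], Node 58 81 [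
    Node 63 83 []]]], Node 74 102 [ Node 32 73 [ Node 72 101 []], Node 32 75 []]]], Node 68 119 [
    Node 58 105 [], Node 63 95 [ Node 64 105 [], Node 29 64 []]], Node 65 105 [ Node 68 119 [
    Node 29 64 [ Node 63 95 []]], Node 68 119 [ Node 29 64 [ Node 63 95 []]], Node 29 66 []]],
    Node 31 67 [ Node 58 119 [], Node 68 119 [ Node 58 105 [], Node 29 64 [ Node 65 105 [
    Node 63 95 []]]], Node 65 105 [ Node 68 119 [ Node 29 64 [ Node 63 95 []]], Node 63 95 [
    Node 68 119 [], Node 29 64 []], Node 29 66 []]], Node 70 88 [ Node 29 64 [ Node 80 106 [
    Node 81 119 [ Node 31 71 [ Node 63 82 []]], Node 63 82 [ Node 81 119 [], Node 31 71 []],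
    Node 72 95 [ Node 78 105 [ Node 63 79 [ Node 31 71 []]], Node 63 79 [ Node 78 105 [],
    Node 31 71 []], Node 31 73 []]], Node 72 105 [ Node 63 79 [ Node 78 119 [], Node 31 71 []],
    Node 63 79 [ Node 78 119 [], Node 31 71 []], Node 31 73 []]], Node 83 106 [ Node 63 85 [
    Node 84 119 [], Node 29 64 [ Node 58 84 []], Node 29 64 [ Node 58 84 []]], Node 58 85 [
    Node 84 119 [], Node 63 87 [ Node 86 119 [], Node 29 64 []], Node 63 87 [ Node 86 119 [],
    Node 29 64 []]], Node 80 105 [ Node 24 59 [ Node 60 84 [ Node 58 81 []], Node 58 84 []],
    Node 63 81 [ Node 29 65 [ Node 78 95 [ Node 58 79 []], Node 64 84 []], Node 65 82 [
    Node 29 64 [ Node 31 66 []], Node 29 66 []], Node 29 64 [ Node 78 95 [ Node 58 79 []]]]]],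
    Node 84 119 [ Node 31 67 [ Node 63 81 [ Node 58 79 [ Node 78 105 [], Node 78 95 [
    Node 80 105 []]], Node 68 85 [ Node 78 105 [], Node 32 69 []], Node 64 83 [ Node 78 95 [
    Node 82 105 []], Node 78 95 [ Node 82 105 []]]], Node 65 86 [ Node 29 64 [ Node 63 85 []],
    Node 29 66 []], Node 65 86 [ Node 29 64 [ Node 63 85 []], Node 29 66 []]], Node 65 86 [
    Node 63 85 [ Node 29 64 [ Node 31 66 []], Node 29 64 [ Node 31 66 []]], Node 67 87 [
    Node 29 66 [ Node 31 68 []], Node 29 68 []], Node 67 87 [ Node 29 66 [ Node 31 68 []],
    Node 29 68 []]]], Node 73 91 [ Node 31 74 [ Node 29 71 []], Node 29 71 [ Node 80 119 [
    Node 58 81 [], Node 78 105 [ Node 58 79 []]]], Node 71 90 [ Node 89 119 [ Node 78 105 []],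
    Node 89 119 [ Node 78 105 []], Node 29 72 []], Node 29 74 []], Node 75 93 [ Node 31 76 [
    Node 29 71 []], Node 78 119 [ Node 29 71 [ Node 58 79 []], Node 72 89 [ Node 29 71 [
    Node 31 73 []], Node 29 73 []]], Node 29 72 [ Node 91 119 [ Node 89 105 [ Node 71 92 [],
    Node 31 74 [ Node 78 95 [ Node 73 90 []]]], Node 89 105 [ Node 71 92 [], Node 31 74 [
    Node 73 92 []]]]], Node 29 76 []]], Node 63 95 [ Node 68 119 [ Node 29 65 [ Node 64 105 [],
    Node 31 67 [ Node 66 105 []]]], Node 29 65 [ Node 66 119 [ Node 64 105 []], Node 44 67 [
    Node 66 119 [], Node 68 119 [ Node 66 105 []]]], Node 29 64 [ Node 67 119 [ Node 31 68 [],
    Node 65 105 [ Node 31 66 []]]], Node 67 119 [ Node 29 64 [ Node 31 68 []], Node 65 96 [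
    Node 29 64 [ Node 31 66 []], Node 29 66 []]]]]]]]]]]"

section \<open>Evaluation of the tree and the value of R(4)\<close>

text \<open>The parameter is 6 rather than 7 because the tree only has to answer the first six
  colors; any further one is the seventh.\<close>

lemma forces_strategy_tree: "forces 4 6 strategy_tree 0 []"
  unfolding strategy_tree_def by code_simp

theorem mainTheorem2: "R 4 = 7"
  unfolding R_def
proof (rule Greatest_equality)
  show "can_force 4 7"
    using can_force_if_forces[OF forces_strategy_tree] by simp
  show "m \<le> 7" if "can_force 4 m" for m
    using can_force_le[OF that] by simp
qed

end
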